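(* Let $\mathfrak{g}$ be a Leibniz algebra over $\mathbb{K}$. Let $\{e_k\}$ be a basis of $\mathrm{Der}_z^{\mathrm{Lie}}(\mathfrak{g})$, let $\{\varphi_j\}$ be a maximal subset of $\Gamma^{\mathrm{Lie}}(\mathfrak{g})$ such that the family of restrictions $\{\varphi_j|_{\gamma_2^{\mathrm{Lie}}(\mathfrak{g})}\}$ is linearly independent, and let $\Psi$ denote the subspace of $\Gamma^{\mathrm{Lie}}(\mathfrak{g})$ spanned by $\{\varphi_j\}$. Then $\{e_k,\varphi_j\}$ is a basis of $\Gamma^{\mathrm{Lie}}(\mathfrak{g})$, and $\Gamma^{\mathrm{Lie}}(\mathfrak{g})=\mathrm{Der}_z^{\mathrm{Lie}}(\mathfrak{g})\oplus\Psi$.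
   Context: $\mathbb{K}$ is a field with $\frac12\in\mathbb{K}$; vector spaces are over $\mathbb{K}$. A Leibniz algebra is a vector space $\mathfrak{g}$ with a bilinear map $[-,-]:\mathfrak{g}\times\mathfrak{g}\to\mathfrak{g}$ satisfying $[x,[y,z]]=[[x,y],z]-[[x,z],y]$ for all $x,y,z\in\mathfrak g$. Put $[x,y]_{\mathrm{Lie}}=[x,y]+[y,x]$. $\gamma_2^{\mathrm{Lie}}(\mathfrak{g})=[\mathfrak g,\mathfrak g]_{\mathrm{Lie}}$ is the two-sided ideal of $\mathfrak g$ generated by all $[x,y]_{\mathrm{Lie}}$, $x,y\in\mathfrak{g}$. The Lie-centre is $Z^{\mathrm{Lie}}(\mathfrak{g})=\{z\in\mathfrak{g}\mid [x,z]_{\mathrm{Lie}}=0\text{ for all }x\in\mathfrak{g}\}$. A Lie-derivation is a linear map $d:\mathfrak{g}\to\mathfrak{g}$ with $d([x,y]_{\mathrm{Lie}})=[d(x),y]_{\mathrm{Lie}}+[x,d(y)]_{\mathrm{Lie}}$ for all $x,y\in\mathfrak g$. $\mathrm{Der}_z^{\mathrm{Lie}}(\mathfrak{g})$ is the set of Lie-central derivations, i.e. Lie-derivations with image contained in $Z^{\mathrm{Lie}}(\mathfrak{g})$. The Lie-centroid $\Gamma^{\mathrm{Lie}}(\mathfrak{g})$ is the set of linear maps $d:\mathfrak{g}\to\mathfrak{g}$ with $d([x,y]_{\mathrm{Lie}})=[d(x),y]_{\mathrm{Lie}}=[x,d(y)]_{\mathrm{Lie}}$ for all $x,y\in\mathfrak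 g$. *)

theory Defs
  imports Complex_Main "HOL-Library.Function_Algebras"
begin

text \<open>
  The vector space structure on maps into a vector space: addition and zero are the pointwise ones
  of \<^theory>\<open>HOL-Library.Function_Algebras\<close>.
\<close>

definition fun_scale :: "('k \<Rightarrow> 'v \<Rightarrow> 'v) \<Rightarrow> 'k \<Rightarrow> ('a \<Rightarrow> 'v) \<Rightarrow> 'a \<Rightarrow> 'v" where
  "fun_scale s c f = (\<lambda>x. s c (f x))"

lemma vector_space_fun_scale:
  fixes s :: "'k::field \<Rightarrow> 'v::ab_group_add \<Rightarrow> 'v"
  assumes "vector_space s"
  shows "vector_space (fun_scale s :: 'k \<Rightarrow> ('a \<Rightarrow> 'v) \<Rightarrow> 'a \<Rightarrow> 'v)"
proof -
  interpret vector_space s by fact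
  show ?thesis
    by unfold_locales
      (auto simp: fun_scale_def fun_eq_iff scale_right_distrib scale_left_distrib)
qed

definition is_basis :: "('k::field \<Rightarrow> 'v::ab_group_add \<Rightarrow> 'v) \<Rightarrow> 'v set \<Rightarrow> 'v set \<Rightarrow> bool" where
  "is_basis s V B \<longleftrightarrow> \<not> module.dependent s B \<and> module.span s B = V"

text \<open>
  Linear independence of a family rather than of its set of values: a family that takes the same
  value at two different indices is dependent.
\<close>

definition independent_family ::
    "('k::field \<Rightarrow> 'v::ab_group_add \<Rightarrow> 'v) \<Rightarrow> 'i set \<Rightarrow> ('i \<Rightarrow> 'v) \<Rightarrow> bool" where
  "independent_family s I v \<longleftrightarrow>
     (\<forall>F c. finite F \<and> F \<subseteq> I \<and> (\<Sum>i\<in>F. s (c i) (v i)) = 0 \<longrightarrow> (\<forall>i\<in>F. c i = 0))"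

definition is_direct_sum :: "'v::ab_group_add set \<Rightarrow> 'v set \<Rightarrow> 'v set \<Rightarrow> bool" where
  "is_direct_sum V U W \<longleftrightarrow> V = {u + w | u w. u \<in> U \<and> w \<in> W} \<and> U \<inter> W = {0}"

text \<open>
  The restriction of a map to \<open>S\<close>, encoded as a total map by extending it by zero outside \<open>S\<close>.
  This embeds the vector space of maps on \<open>S\<close> linearly into that of all maps, so linear
  independence of restrictions has its usual meaning.
\<close>

definition restriction :: "'a set \<Rightarrow> ('a \<Rightarrow> 'v::zero) \<Rightarrow> 'a \<Rightarrow> 'v" where
  "restriction S f = (\<lambda>x. if x \<in> S then f x else 0)"

locale leibniz_algebra = vector_space scale
  for scale :: "'k::field \<Rightarrow> 'g::ab_group_add \<Rightarrow> 'g" +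
  fixes bracket :: "'g \<Rightarrow> 'g \<Rightarrow> 'g"
  assumes linear_bracket_left: "Vector_Spaces.linear scale scale (\<lambda>x. bracket x y)"
    and linear_bracket_right: "Vector_Spaces.linear scale scale (\<lambda>y. bracket x y)"
    and leibniz_identity:
      "bracket x (bracket y z) = bracket (bracket x y) z - bracket (bracket x z) y"
begin

definition lie_bracket :: "'g \<Rightarrow> 'g \<Rightarrow> 'g" where
  "lie_bracket x y = bracket x y + bracket y x"

definition two_sided_ideal :: "'g set \<Rightarrow> bool" where
  "two_sided_ideal I \<longleftrightarrow> subspace I \<and> (\<forall>x\<in>I. \<forall>y. bracket x y \<in> I \<and> bracket y x \<in> I)"

definition lie_gamma2 :: "'g set" where
  "lie_gamma2 = two_sided_ideal hull {lie_bracket x y | x y. True}"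

definition lie_centre :: "'g set" where
  "lie_centre = {z. \<forall>x. lie_bracket x z = 0}"

definition lie_derivation :: "('g \<Rightarrow> 'g) \<Rightarrow> bool" where
  "lie_derivation d \<longleftrightarrow> Vector_Spaces.linear scale scale d \<and>
     (\<forall>x y. d (lie_bracket x y) = lie_bracket (d x) y + lie_bracket x (d y))"

definition lie_central_derivations :: "('g \<Rightarrow> 'g) set" where
  "lie_central_derivations = {d. lie_derivation d \<and> range d \<subseteq> lie_centre}"

definition lie_centroid :: "('g \<Rightarrow> 'g) set" where
  "lie_centroid = {d. Vector_Spaces.linear scale scale d \<and>
     (\<forall>x y. d (lie_bracket x y) = lie_bracket (d x) y \<and>
            d (lie_bracket x y) = lie_bracket x (d y))}"

definition restriction_independent :: "('g \<Rightarrow> 'g) set \<Rightarrow> bool" where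
  "restriction_independent \<Phi> \<longleftrightarrow> \<Phi> \<subseteq> lie_centroid \<and>
     independent_family (fun_scale scale) \<Phi> (restriction lie_gamma2)"

end

end

theory Submission
  imports Defs
begin

text \<open>
  Since \<open>\<gamma>\<^sub>2\<close> is spanned by the Lie-brackets, the Lie-central derivations are
  exactly the elements of the Lie-centroid whose restriction to \<open>\<gamma>\<^sub>2\<close> vanishes. The claim is thus the
  splitting of a vector space into the kernel of a linear map (here, restriction to \<open>\<gamma>\<^sub>2\<close>) and
  the span of a maximal family with linearly independent images.
\<close>

section \<open>Linear algebra: independent families and splitting along a kernel\<close>

context vector_space
begin

lemma independent_Un:
  assumes "independent A" and "independent B" and inter: "span A \<inter> span B \<subseteq> {0}"
  shows "independent (A \<union> B)"
  unfolding independent_explicit_module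
proof (intro allI impI)
  fix F c v
  assume F: "finite F" "F \<subseteq> A \<union> B" and sum0: "(\<Sum>w\<in>F. c w *s w) = 0" and v: "v \<in> F"
  \<comment> \<open>Vectors lying in both \<open>A\<close> and \<open>B\<close> are counted in
    \<open>?x\<close> only, so the split is valid even if the sets overlap.\<close>
  let ?x = "\<Sum>w\<in>F \<inter> A. c w *s w" and ?y = "\<Sum>w\<in>F - A. c w *s w"
  have x: "?x \<in> span A"
    by (intro span_sum span_scale span_base) simp
  have y: "?y \<in> span B"
    using F(2) by (intro span_sum span_scale span_base) auto
  have "?x + ?y = 0"
    using sum.Int_Diff[OF F(1), of "\<lambda>w. c w *s w" A] sum0 by simp
  then have "?x = - ?y"
    by (simp add: eq_neg_iff_add_eq_0)
  \<comment> \<open>Being \<open>- ?y\<close>, the vector \<open>?x\<close> lies in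
    \<open>span B\<close> as well as in \<open>span A\<close>.\<close>
  then have "?x = 0"
    using x y inter span_neg by fastforce
  then have "?y = 0"
    using \<open>?x + ?y = 0\<close> by simp
  show "c v = 0"
  proof (cases "v \<in> A")
    case True
    then show ?thesis
      using independentD[OF assms(1) _ _ \<open>?x = 0\<close>] F v by auto
  next
    case False
    then show ?thesis
      using independentD[OF assms(2) _ _ \<open>?y = 0\<close>] F v by auto
  qed
qed

text \<open>This turns maximality into spanning: an index whose value escapes the span could be
  added. A relation with nonzero coefficient at \<open>j\<close> could be solved for
  \<open>v j\<close>, putting it in the span.\<close>

lemma independent_family_insert:
  assumes I: "independent_family scale I v" and j: "v j \<notin> span (v ` I)"
  shows "independent_family scale (insert j I) v"
  unfolding independent_family_def
proof (intro allI impI)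
  fix F c
  assume "finite F \<and> F \<subseteq> insert j I \<and> (\<Sum>i\<in>F. c i *s v i) = 0"
  then have F: "finite F" "F \<subseteq> insert j I" and sum0: "(\<Sum>i\<in>F. c i *s v i) = 0"
    by auto
  let ?rest = "\<Sum>i\<in>F - {j}. c i *s v i"
  have rest: "?rest \<in> span (v ` I)"
    using F(2) by (intro span_sum span_scale span_base) auto
  have cj: "c j = 0" if "j \<in> F"
  proof (rule ccontr)
    assume nz: "c j \<noteq> 0"
    have "c j *s v j + ?rest = 0"
      using sum.remove[OF F(1) that, of "\<lambda>i. c i *s v i"] sum0 by simp
    then have "c j *s v j = - ?rest"
      by (simp add: eq_neg_iff_add_eq_0)
    then have "c j *s v j \<in> span (v ` I)"
      using rest span_neg by simp
    then have "inverse (c j) *s (c j *s v j) \<in> span (v ` I)"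
      by (rule span_scale)
    with nz j show False by simp
  qed
  have "?rest = 0"
    using sum.remove[OF F(1), of j "\<lambda>i. c i *s v i"] sum0 cj by (cases "j \<in> F") auto
  then have "\<forall>i\<in>F - {j}. c i = 0"
    using I F unfolding independent_family_def by (metis Diff_subset_conv finite_Diff insert_is_Un)
  with cj show "\<forall>i\<in>F. c i = 0" by blast
qed

end

text \<open>By linearity \<open>f\<close> sends a combination of elements of \<open>A\<close> to the
  combination of their images with the same coefficients. If that image is zero, all coefficients
  vanish; hence \<open>f\<close> is injective on the span of \<open>A\<close>.\<close>

lemma (in Vector_Spaces.linear) independent_family_image:
  assumes "independent_family s2 A f"
  shows "vs1.independent A"
    and "x \<in> vs1.span A \<Longrightarrow> f x = 0 \<Longrightarrow> x = 0"
proof -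
  have coeff: "c w = 0"
    if "finite F" "F \<subseteq> A" "f (\<Sum>w\<in>F. s1 (c w) w) = 0" "w \<in> F" for F c w
    using assms that unfolding independent_family_def by (simp add: sum scale)
  show "vs1.independent A"
    unfolding vs1.independent_explicit_module using coeff by (metis zero)
  assume "x \<in> vs1.span A" "f x = 0"
  then show "x = 0"
    unfolding vs1.span_explicit using coeff by (auto intro!: sum.neutral)
qed

text \<open>Injectivity of \<open>f\<close> on the span of \<open>B\<close> makes the intersection
  with the kernel trivial. Maximality lets each \<open>f g\<close> be matched by some
  \<open>f w\<close> with \<open>w\<close> in the span of \<open>B\<close>, and \<open>g - w\<close>
  then lies in the kernel.\<close>

lemma (in Vector_Spaces.linear) kernel_basis_Un_maximal_independent:
  assumes G: "vs1.subspace G"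
    and E: "is_basis s1 {x \<in> G. f x = 0} E"
    and B: "B \<subseteq> G" "independent_family s2 B f"
    and maximal: "\<And>B'. B \<subset> B' \<Longrightarrow> B' \<subseteq> G \<Longrightarrow> \<not> independent_family s2 B' f"
  shows "E \<inter> B = {}"
    and "is_basis s1 G (E \<union> B)"
    and "is_direct_sum G {x \<in> G. f x = 0} (vs1.span B)"
proof -
  let ?K = "{x \<in> G. f x = 0}"
  have indE: "vs1.independent E" and spanE: "vs1.span E = ?K"
    using E by (auto simp: is_basis_def)
  have spanB: "vs1.span B \<subseteq> G"
    using B(1) G by (rule vs1.span_minimal)
  have inter: "?K \<inter> vs1.span B = {0}"
    using independent_family_image(2)[OF B(2)] vs1.subspace_0[OF G] vs1.span_zero zero by auto
  have "g \<in> {u + w | u w. u \<in> ?K \<and> w \<in> vs1.span B}" if g: "g \<in> G" for g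
  proof -
    have "f g \<in> vs2.span (f ` B)"
    proof (rule ccontr)
      assume notin: "f g \<notin> vs2.span (f ` B)"
      \<comment> \<open>Needed so that \<open>insert g B\<close> is strictly larger than
        \<open>B\<close>, as \<open>maximal\<close> demands.\<close>
      then have "g \<notin> B"
        using vs2.span_base by blast
      then show False
        using maximal[of "insert g B"] vs2.independent_family_insert[OF B(2) notin] g B(1) by blast
    qed
    then obtain w where w: "w \<in> vs1.span B" "f g = f w"
      by (auto simp: span_image)
    then have "g - w \<in> ?K"
      using g spanB vs1.subspace_diff[OF G] by (auto simp: diff)
    then show ?thesis
      using w(1) by (smt (verit) diff_add_cancel mem_Collect_eq)
  qed
  then have sum: "G = {u + w | u w. u \<in> ?K \<and> w \<in> vs1.span B}"
    using spanB vs1.subspace_add[OF G] by blast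
  show "is_direct_sum G ?K (vs1.span B)"
    using sum inter by (simp add: is_direct_sum_def)
  show "is_basis s1 G (E \<union> B)"
    unfolding is_basis_def
  proof
    show "vs1.independent (E \<union> B)"
      using inter spanE
      by (intro vs1.independent_Un indE independent_family_image(1)[OF B(2)]) simp
    show "vs1.span (E \<union> B) = G"
      using sum by (simp add: vs1.span_Un spanE)
  qed
  \<comment> \<open>A common element lies in both summands, so it is zero, and zero cannot belong to
    the independent set \<open>E\<close>.\<close>
  show "E \<inter> B = {}"
  proof -
    have "E \<inter> B \<subseteq> {0}"
      using inter spanE vs1.span_base by blast
    moreover have "0 \<notin> E"
      using indE vs1.dependent_zero by blast
    ultimately show ?thesis by blast
  qed
qed

lemma linear_restriction:
  assumes "vector_space s"
  shows "Vector_Spaces.linear (fun_scale s) (fun_scale s) (restriction S)"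
proof -
  interpret vector_space s by fact
  show ?thesis
    by (auto simp: Vector_Spaces.linear_iff vector_space_fun_scale[OF assms] restriction_def
        fun_scale_def fun_eq_iff)
qed

section \<open>Leibniz algebras: Lie-brackets, \<open>lie_gamma2\<close> and the
  Lie-centroid\<close>

context leibniz_algebra
begin

lemma bracket_add_left: "bracket (x + x') y = bracket x y + bracket x' y"
  and bracket_scale_left: "bracket (scale c x) y = scale c (bracket x y)"
  using linear_bracket_left[of y] by (auto simp: Vector_Spaces.linear_iff)

lemma bracket_add_right: "bracket x (y + y') = bracket x y + bracket x y'"
  and bracket_scale_right: "bracket x (scale c y) = scale c (bracket x y)"
  using linear_bracket_right[of x] by (auto simp: Vector_Spaces.linear_iff)

lemma lie_bracket_commute: "lie_bracket x y = lie_bracket y x"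
  by (simp add: lie_bracket_def add.commute)

lemma lie_bracket_add_left: "lie_bracket (x + x') y = lie_bracket x y + lie_bracket x' y"
  by (simp add: lie_bracket_def bracket_add_left bracket_add_right algebra_simps)

lemma lie_bracket_scale_left: "lie_bracket (scale c x) y = scale c (lie_bracket x y)"
  by (simp add: lie_bracket_def bracket_scale_left bracket_scale_right scale_right_distrib)

lemma lie_bracket_zero_left: "lie_bracket 0 y = 0"
  using lie_bracket_add_left[of 0 0 y] by simp

text \<open>The right-hand side of the Leibniz identity changes sign when \<open>y\<close> and
  \<open>z\<close> are swapped, so symmetrising cancels it.\<close>

lemma bracket_lie_bracket_right: "bracket x (lie_bracket y z) = 0"
  by (simp add: lie_bracket_def bracket_add_right leibniz_identity[of x y z]
      leibniz_identity[of x z y])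

text \<open>The Leibniz identity says that right multiplication by \<open>x\<close> is a derivation
  of the bracket; it is therefore a derivation of the symmetrised bracket too.\<close>

lemma bracket_lie_bracket_left:
  "bracket (lie_bracket y z) x = lie_bracket (bracket y x) z + lie_bracket y (bracket z x)"
  by (simp add: lie_bracket_def bracket_add_left leibniz_identity[of y z x]
      leibniz_identity[of z y x])

lemma two_sided_ideal_span_lie_brackets: "two_sided_ideal (span {lie_bracket x y | x y. True})"
  (is "two_sided_ideal (span ?L)")
  unfolding two_sided_ideal_def
proof (intro conjI ballI allI)
  fix x y assume x: "x \<in> span ?L"
  have L: "lie_bracket u v \<in> span ?L" for u v
    by (rule span_base) blast
  show "bracket x y \<in> span ?L"
  proof (rule span_induct[OF x])
    have "module_hom scale scale (\<lambda>x. bracket x y)"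
      using linear_bracket_left by (simp add: module_hom_iff_linear)
    then show "subspace {x. bracket x y \<in> span ?L}"
      by (rule module_hom.subspace_linear_preimage) (rule subspace_span)
  next
    fix l assume "l \<in> ?L"
    then show "bracket l y \<in> span ?L"
      using L by (auto simp: bracket_lie_bracket_left intro!: span_add)
  qed
  \<comment> \<open>Left multiplication kills every generator. Writing this as membership in the
    subspace \<open>{0}\<close> gives the induction predicate as a linear preimage.\<close>
  have "bracket y x \<in> {0}"
  proof (rule span_induct[OF x])
    have "module_hom scale scale (bracket y)"
      using linear_bracket_right by (simp add: module_hom_iff_linear)
    then show "subspace {x. bracket y x \<in> {0}}"
      by (rule module_hom.subspace_linear_preimage) (rule subspace_single_0)
  qed (auto simp: bracket_lie_bracket_right)
  then show "bracket y x \<in> span ?L"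
    by (simp add: span_zero)
qed (rule subspace_span)

text \<open>The plain span is already an ideal, so the hull adds nothing. A linear map thus vanishes
  on \<open>lie_gamma2\<close> as soon as it vanishes on all Lie-brackets, although it need not
  respect \<open>bracket\<close>.\<close>

lemma lie_gamma2_eq_span: "lie_gamma2 = span {lie_bracket x y | x y. True}"
  unfolding lie_gamma2_def
proof (rule hull_unique)
  show "span {lie_bracket x y | x y. True} \<subseteq> I"
    if "{lie_bracket x y | x y. True} \<subseteq> I" "two_sided_ideal I" for I
    using that by (intro span_minimal) (auto simp: two_sided_ideal_def)
qed (use span_superset two_sided_ideal_span_lie_brackets in auto)

lemma restriction_lie_gamma2_eq_0_iff:
  assumes "Vector_Spaces.linear scale scale d"
  shows "restriction lie_gamma2 d = 0 \<longleftrightarrow> (\<forall>x y. d (lie_bracket x y) = 0)"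
proof
  assume "restriction lie_gamma2 d = 0"
  then have "d x = 0" if "x \<in> lie_gamma2" for x
    using that by (auto simp: restriction_def fun_eq_iff split: if_splits)
  then show "\<forall>x y. d (lie_bracket x y) = 0"
    by (auto simp: lie_gamma2_eq_span intro: span_base)
next
  assume "\<forall>x y. d (lie_bracket x y) = 0"
  then have "d x = 0" if "x \<in> lie_gamma2" for x
    using that assms unfolding lie_gamma2_eq_span module_hom_iff_linear[symmetric]
    by (elim module_hom.eq_0_on_span) auto
  then show "restriction lie_gamma2 d = 0"
    by (auto simp: restriction_def)
qed

text \<open>For a Lie-central derivation both terms of the derivation rule are zero, so it kills
  Lie-brackets and the centroid equations read 0 = 0. Conversely, for \<open>d\<close> in the
  centroid, \<open>lie_bracket x (d y)\<close> equals \<open>d (lie_bracket x y)\<close>, so killing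
  Lie-brackets forces the values of \<open>d\<close> into the Lie-centre.\<close>

lemma lie_central_derivations_eq_kernel:
  "lie_central_derivations = {d \<in> lie_centroid. restriction lie_gamma2 d = 0}"
proof (intro set_eqI iffI)
  fix d assume d: "d \<in> lie_central_derivations"
  then have lin: "Vector_Spaces.linear scale scale d" and "d x \<in> lie_centre" for x
    by (auto simp: lie_central_derivations_def lie_derivation_def)
  then have 0: "lie_bracket x (d y) = 0" "lie_bracket (d x) y = 0" for x y
    using lie_bracket_commute by (auto simp: lie_centre_def)
  then have "d (lie_bracket x y) = 0" for x y
    using d by (auto simp: lie_central_derivations_def lie_derivation_def)
  then show "d \<in> {d \<in> lie_centroid. restriction lie_gamma2 d = 0}"
    using lin 0 by (simp add: lie_centroid_def restriction_lie_gamma2_eq_0_iff)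
next
  fix d assume d: "d \<in> {d \<in> lie_centroid. restriction lie_gamma2 d = 0}"
  then have lin: "Vector_Spaces.linear scale scale d"
    by (simp add: lie_centroid_def)
  then have "d (lie_bracket x y) = 0" for x y
    using d by (simp add: restriction_lie_gamma2_eq_0_iff)
  then have "lie_bracket (d x) y = 0" "lie_bracket x (d y) = 0" "d (lie_bracket x y) = 0" for x y
    using d by (auto simp: lie_centroid_def)
  then show "d \<in> lie_central_derivations"
    using lin by (auto simp: lie_central_derivations_def lie_derivation_def lie_centre_def)
qed

lemma subspace_lie_centroid: "module.subspace (fun_scale scale) lie_centroid"
proof -
  interpret maps: vector_space "fun_scale scale :: 'k \<Rightarrow> ('g \<Rightarrow> 'g) \<Rightarrow> 'g \<Rightarrow> 'g"
    by (rule vector_space_fun_scale) unfold_locales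
  have add_right: "lie_bracket x (y + y') = lie_bracket x y + lie_bracket x y'" for x y y'
    by (metis lie_bracket_add_left lie_bracket_commute)
  have scale_right: "lie_bracket x (scale c y) = scale c (lie_bracket x y)" for x c y
    by (metis lie_bracket_scale_left lie_bracket_commute)
  have zero_right: "lie_bracket x 0 = 0" for x
    by (metis lie_bracket_zero_left lie_bracket_commute)
  show ?thesis
    by (rule maps.subspaceI,
        simp_all add: lie_centroid_def Vector_Spaces.linear_iff vector_space_axioms fun_scale_def
        lie_bracket_add_left add_right lie_bracket_scale_left scale_right lie_bracket_zero_left
        zero_right scale_right_distrib add_ac mult.commute)
      metis+
qed

end

theorem theorem3p8:
  fixes scale :: "'k::field \<Rightarrow> 'g::ab_group_add \<Rightarrow> 'g"
    and bracket :: "'g \<Rightarrow> 'g \<Rightarrow> 'g"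
    and E \<Phi> \<Psi> :: "('g \<Rightarrow> 'g) set"
  assumes half: "(2::'k) \<noteq> 0"
    and leibniz: "leibniz_algebra scale bracket"
    and E: "is_basis (fun_scale scale) (leibniz_algebra.lie_central_derivations scale bracket) E"
    and \<Phi>: "leibniz_algebra.restriction_independent scale bracket \<Phi>"
    and maximal: "\<And>\<Phi>'. \<Phi> \<subset> \<Phi>' \<Longrightarrow> \<not> leibniz_algebra.restriction_independent scale bracket \<Phi>'"
    and \<Psi>: "\<Psi> = module.span (fun_scale scale) \<Phi>"
  shows "E \<inter> \<Phi> = {} \<and>
         is_basis (fun_scale scale) (leibniz_algebra.lie_centroid scale bracket) (E \<union> \<Phi>) \<and>
         is_direct_sum (leibniz_algebra.lie_centroid scale bracket)
           (leibniz_algebra.lie_central_derivations scale bracket) \<Psi>"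
proof -
  interpret leibniz_algebra scale bracket by fact
  interpret restrict: Vector_Spaces.linear "fun_scale scale" "fun_scale scale"
    "restriction lie_gamma2 :: ('g \<Rightarrow> 'g) \<Rightarrow> 'g \<Rightarrow> 'g"
    by (rule linear_restriction) unfold_locales
  show ?thesis
    \<comment> \<open>Containment in the centroid is part of \<open>restriction_independent\<close>,
      so \<open>maximal\<close> unfolds to the maximality condition of the linear lemma with the
      centroid as \<open>G\<close>.\<close>
    using restrict.kernel_basis_Un_maximal_independent[OF subspace_lie_centroid, of E \<Phi>]
      E \<Phi> maximal
    unfolding \<Psi> lie_central_derivations_eq_kernel restriction_independent_def by blast
qed

end
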